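(* $\mathsf{IPT}^2_2$ is strongly computably reducible to $\mathsf{HT}^{=2}_2$ with apartness.
   Context: $\mathbb{N}$ denotes the positive integers, $\mathbb{N}_0=\mathbb{N}\cup\{0\}$. For $m\in\mathbb{N}$, $\lambda(m)$ and $\mu(m)$ are the least and greatest exponents in the binary expansion of $m$; $X\subseteq\mathbb{N}$ is apart if for all $x<x'$ in $X$, $\mu(x)<\lambda(x')$. $\mathsf{HT}^{=2}_2$ with apartness: for every $f:\mathbb{N}\to 2$ there is an infinite apart $H\subseteq\mathbb{N}$ such that $f$ is constant on $\{x+y: x,y\in H, x\neq y\}$. $\mathsf{IPT}^2_2$ (increasing polarized Ramsey theorem): for every $c:[\mathbb{N}_0]^2\to 2$ there are infinite $H_1,H_2\subseteq\mathbb{N}$ such that $c(\{x_1,x_2\})$ is the same for all $x_1\in H_1$, $x_2\in H_2$ with $x_1<x_2$. $\mathsf{Q}$ is strongly computably reducible to $\mathsf{P}$ if for every instance $I$ of $\mathsf{Q}$ there is an instance $J$ of $\mathsf{P}$ computable from $I$ such that every solution of $J$ computes a solution of $I$. *)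

theory Defs
  imports "HOL-Library.Ramsey" "HOL-Library.Nat_Bijection"
begin

text \<open>
  Kleene's schemes for the partial functions that are recursive relative to an oracle
  \<open>g\<close>, given by a syntax of programs and a big-step evaluation relation;
  \<open>ev g p xs y\<close> says that \<open>p\<close> halts on the argument tuple \<open>xs\<close> with value \<open>y\<close>.
\<close>

datatype prog =
    Zero
  | Succ
  | Proj nat
  | Query
  | Comp prog "prog list"
  | Prec prog prog
  | Mu prog

inductive ev :: "(nat \<Rightarrow> nat) \<Rightarrow> prog \<Rightarrow> nat list \<Rightarrow> nat \<Rightarrow> bool" for g where
  Zero: "ev g Zero xs 0"
| Succ: "ev g Succ [x] (Suc x)"
| Proj: "i < length xs \<Longrightarrow> ev g (Proj i) xs (xs ! i)"
| Query: "ev g Query [x] (g x)"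
| Comp: "list_all2 (\<lambda>q y. ev g q xs y) qs ys \<Longrightarrow> ev g p ys z \<Longrightarrow> ev g (Comp p qs) xs z"
| Prec_0: "ev g p xs y \<Longrightarrow> ev g (Prec p q) (0 # xs) y"
| Prec_Suc: "ev g (Prec p q) (n # xs) y \<Longrightarrow> ev g q (n # y # xs) z \<Longrightarrow>
    ev g (Prec p q) (Suc n # xs) z"
| Mu: "ev g p (n # xs) 0 \<Longrightarrow> (\<And>m. m < n \<Longrightarrow> \<exists>y>0. ev g p (m # xs) y) \<Longrightarrow> ev g (Mu p) xs n"

inductive_cases ev_ZeroE: "ev g Zero xs y"
inductive_cases ev_SuccE: "ev g Succ xs y"
inductive_cases ev_ProjE: "ev g (Proj i) xs y"
inductive_cases ev_QueryE: "ev g Query xs y"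
inductive_cases ev_CompE: "ev g (Comp p qs) xs y"
inductive_cases ev_Prec_0E: "ev g (Prec p q) (0 # xs) y"
inductive_cases ev_Prec_SucE: "ev g (Prec p q) (Suc n # xs) y"
inductive_cases ev_MuE: "ev g (Mu p) xs y"

lemma ev_deterministic: "ev g p xs y \<Longrightarrow> ev g p xs z \<Longrightarrow> y = z"
proof (induction arbitrary: z rule: ev.induct)
  case (Zero xs)
  then show ?case by (auto elim: ev_ZeroE)
next
  case (Succ x)
  then show ?case by (auto elim: ev_SuccE)
next
  case (Proj i xs)
  from Proj.prems show ?case by (auto elim: ev_ProjE)
next
  case (Query x)
  then show ?case by (auto elim: ev_QueryE)
next
  case (Comp xs qs ys p w)
  from Comp.prems obtain ys' where ys': "list_all2 (\<lambda>q y. ev g q xs y) qs ys'" "ev g p ys' z"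
    by (auto elim: ev_CompE)
  have "ys = ys'"
  proof (rule nth_equalityI)
    show "length ys = length ys'"
      using list_all2_lengthD[OF Comp.IH(1)] list_all2_lengthD[OF ys'(1)] by simp
  next
    fix i assume "i < length ys"
    then have i: "i < length qs" using list_all2_lengthD[OF Comp.IH(1)] by simp
    show "ys ! i = ys' ! i"
      using list_all2_nthD[OF Comp.IH(1) i] list_all2_nthD[OF ys'(1) i] by blast
  qed
  then show ?case using Comp.IH(2) ys'(2) by blast
next
  case (Prec_0 p xs y q)
  from Prec_0.prems have "ev g p xs z" by (auto elim: ev_Prec_0E)
  then show ?case by (rule Prec_0.IH)
next
  case (Prec_Suc p q n xs y w)
  from Prec_Suc.prems obtain y' where "ev g (Prec p q) (n # xs) y'" "ev g q (n # y' # xs) z"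
    by (auto elim: ev_Prec_SucE)
  then show ?case using Prec_Suc.IH by blast
next
  case (Mu p n xs)
  from Mu.prems have z: "ev g p (z # xs) 0" "\<And>m. m < z \<Longrightarrow> \<exists>y>0. ev g p (m # xs) y"
    by (auto elim: ev_MuE)
  have "\<not> z < n" using Mu.IH(2) z(1) by blast
  moreover have "\<not> n < z" using Mu.IH(1) z(2) by blast
  ultimately show ?case by simp
qed

definition computable_from :: "(nat \<Rightarrow> nat) \<Rightarrow> (nat \<Rightarrow> nat) \<Rightarrow> bool" (infix \<open>\<le>\<^sub>T\<close> 50)
  where "f \<le>\<^sub>T g \<longleftrightarrow> (\<exists>p. \<forall>n. ev g p [n] (f n))"

text \<open>
  A problem comes with fixed codings of its instances and solutions as functions on the
  natural numbers, through which computability is understood.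
\<close>

record ('i, 's) problem =
  instances :: "'i set"
  solutions :: "'i \<Rightarrow> 's set"
  icode :: "'i \<Rightarrow> nat \<Rightarrow> nat"
  scode :: "'s \<Rightarrow> nat \<Rightarrow> nat"

definition strongly_computably_reducible ::
    "('i, 's) problem \<Rightarrow> ('j, 't) problem \<Rightarrow> bool" (infix \<open>\<le>\<^sub>s\<^sub>c\<close> 50)
  where "Q \<le>\<^sub>s\<^sub>c P \<longleftrightarrow>
    (\<forall>I \<in> instances Q. \<exists>J \<in> instances P. icode P J \<le>\<^sub>T icode Q I \<and>
      (\<forall>S \<in> solutions P J. \<exists>T \<in> solutions Q I. scode Q T \<le>\<^sub>T scode P S))"

definition set_code :: "nat set \<Rightarrow> nat \<Rightarrow> nat"
  where "set_code H n = of_bool (n \<in> H)"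

definition set_pair_code :: "nat set \<times> nat set \<Rightarrow> nat \<Rightarrow> nat"
  where "set_pair_code = (\<lambda>(H1, H2) n.
    if even n then set_code H1 (n div 2) else set_code H2 (n div 2))"

text \<open>
  The two codes below ignore values outside the intended domain, which are arbitrary in HOL.
\<close>

definition colouring_code :: "(nat \<Rightarrow> nat) \<Rightarrow> nat \<Rightarrow> nat"
  where "colouring_code f n = (if n \<ge> 1 then f n else 0)"

definition pair_colouring_code :: "(nat set \<Rightarrow> nat) \<Rightarrow> nat \<Rightarrow> nat"
  where "pair_colouring_code c n =
    (case prod_decode n of (x, y) \<Rightarrow> if x \<noteq> y then c {x, y} else 0)"

definition least_exponent :: "nat \<Rightarrow> nat"
  where "least_exponent m = Min {i. bit m i}"

definition greatest_exponent :: "nat \<Rightarrow> nat"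
  where "greatest_exponent m = Max {i. bit m i}"

definition apart :: "nat set \<Rightarrow> bool"
  where "apart X \<longleftrightarrow>
    (\<forall>x \<in> X. \<forall>x' \<in> X. x < x' \<longrightarrow> greatest_exponent x < least_exponent x')"

definition HT_exactly_2_2_apart :: "(nat \<Rightarrow> nat, nat set) problem"
  where "HT_exactly_2_2_apart =
    \<lparr> instances = {1..} \<rightarrow> {..<2},
      solutions = (\<lambda>f. {H. H \<subseteq> {1..} \<and> infinite H \<and> apart H \<and>
        (\<exists>i. \<forall>z \<in> {x + y | x y. x \<in> H \<and> y \<in> H \<and> x \<noteq> y}. f z = i)}),
      icode = colouring_code,
      scode = set_code \<rparr>"

definition IPT_2_2 :: "(nat set \<Rightarrow> nat, nat set \<times> nat set) problem"
  where "IPT_2_2 =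
    \<lparr> instances = [UNIV]\<^bsup>2\<^esup> \<rightarrow> {..<2},
      solutions = (\<lambda>c. {(H1, H2). H1 \<subseteq> {1..} \<and> H2 \<subseteq> {1..} \<and> infinite H1 \<and> infinite H2 \<and>
        (\<exists>i. \<forall>x1 \<in> H1. \<forall>x2 \<in> H2. x1 < x2 \<longrightarrow> c {x1, x2} = i)}),
      icode = pair_colouring_code,
      scode = set_pair_code \<rparr>"

end

theory Submission
  imports Defs
begin

text \<open>
  A pair colouring \<open>c\<close> is turned into the colouring of \<open>n\<close> by \<open>c {\<lambda> n, \<mu> n}\<close>. If \<open>H\<close> is apart
  and \<open>x < y\<close> are in \<open>H\<close>, then \<open>\<lambda> (x + y) = \<lambda> x\<close> and \<open>\<mu> (x + y) = \<mu> y\<close>, so a solution \<open>H\<close>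
  controls \<open>c {\<lambda> x, \<mu> y}\<close> for \<open>x < y\<close>, but not \<open>c {\<lambda> x, \<mu> x}\<close>. Taking \<open>\<lambda>\<close> of the elements of
  even index and \<open>\<mu>\<close> of those of odd index avoids the uncontrolled pairs. Both sets are
  computable from \<open>H\<close>: by apartness, an \<open>h \<in> H\<close> with \<open>\<lambda> h = m\<close> or \<open>\<mu> h = m\<close> can only be the
  least element of \<open>H\<close> that is at least \<open>2 ^ m\<close>.
\<close>

section \<open>Total functions recursive in an oracle\<close>

text \<open>\<open>F\<close> acts on the whole argument list, so that composition is pointwise under
  \<open>\<lambda>xs\<close> and the closure lemmas can be applied along the syntax of a
  term.\<close>

definition recursive_in :: "(nat \<Rightarrow> nat) \<Rightarrow> nat \<Rightarrow> (nat list \<Rightarrow> nat) \<Rightarrow> bool"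
  where "recursive_in g k F \<longleftrightarrow> (\<exists>p. \<forall>xs. length xs = k \<longrightarrow> ev g p xs (F xs))"

lemma recursive_inI: "(\<And>xs. length xs = k \<Longrightarrow> ev g p xs (F xs)) \<Longrightarrow> recursive_in g k F"
  unfolding recursive_in_def by blast

lemma recursive_inE:
  assumes "recursive_in g k F"
  obtains p where "\<And>xs. length xs = k \<Longrightarrow> ev g p xs (F xs)"
  using assms unfolding recursive_in_def by blast

lemma computable_from_iff_recursive_in: "f \<le>\<^sub>T g \<longleftrightarrow> recursive_in g 1 (\<lambda>xs. f (hd xs))"
  unfolding computable_from_def recursive_in_def
  by (intro arg_cong[where f = Ex] ext) (auto simp: length_Suc_conv)

text \<open>Argument lists for \<open>Comp\<close> that copy a tuple: \<open>m = 0\<close> keeps all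
  of it, \<open>m = 1\<close> drops its head.\<close>

lemma list_all2_ev_Proj:
  "list_all2 (\<lambda>q y. ev g q xs y) (map Proj [m..<length xs]) (drop m xs)"
  by (auto simp: list_all2_conv_all_nth intro!: ev.Proj[of "m + _", simplified])

text \<open>Recursion and search place new arguments in front of the tuple; parameter functions are
  carried past them one at a time.\<close>

lemma recursive_weaken:
  assumes "recursive_in g k F"
  shows "recursive_in g (Suc k) (\<lambda>xs. F (tl xs))"
proof -
  obtain p where p: "\<And>xs. length xs = k \<Longrightarrow> ev g p xs (F xs)"
    by (rule recursive_inE[OF assms]) blast
  show ?thesis
  proof (rule recursive_inI)
    fix xs :: "nat list" assume xs: "length xs = Suc k"
    have "list_all2 (\<lambda>q y. ev g q xs y) (map Proj [1..<length xs]) (drop 1 xs)"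
      by (rule list_all2_ev_Proj)
    then show "ev g (Comp p (map Proj [1..<Suc k])) xs (F (tl xs))"
      using xs by (auto intro!: ev.Comp p simp: drop_Suc)
  qed
qed

lemma recursive_hd: "recursive_in g (Suc k) hd"
proof (rule recursive_inI)
  fix xs :: "nat list" assume "length xs = Suc k"
  then show "ev g (Proj 0) xs (hd xs)"
    using ev.Proj[of 0 xs g] by (cases xs) auto
qed

lemma recursive_hd_tl: "recursive_in g (Suc (Suc k)) (\<lambda>xs. hd (tl xs))"
  using recursive_hd by (rule recursive_weaken)

lemma recursive_comp1:
  assumes p: "\<And>x. ev g p [x] (f x)" and F: "recursive_in g k F"
  shows "recursive_in g k (\<lambda>xs. f (F xs))"
proof -
  obtain q where "\<And>xs. length xs = k \<Longrightarrow> ev g q xs (F xs)"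
    by (rule recursive_inE[OF F]) blast
  then show ?thesis
    by (intro recursive_inI[of k g "Comp p [q]"] ev.Comp[where ys = "[F _]"]) (auto intro: p)
qed

lemma recursive_Suc: "recursive_in g k F \<Longrightarrow> recursive_in g k (\<lambda>xs. Suc (F xs))"
  by (rule recursive_comp1) (rule ev.Succ)

lemma recursive_oracle: "recursive_in g k F \<Longrightarrow> recursive_in g k (\<lambda>xs. g (F xs))"
  by (rule recursive_comp1) (rule ev.Query)

lemma recursive_const: "recursive_in g k (\<lambda>xs. n)"
proof (induction n)
  case 0
  show ?case by (rule recursive_inI) (rule ev.Zero)
qed (rule recursive_Suc)

text \<open>\<open>Prec\<close> recurses on the head of its argument list with the rest as
  parameters, so it is applied to \<open>N xs # xs\<close>. The assumption on \<open>G\<close>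
  follows the order of the rule \<open>Prec_Suc\<close>: counter, previous value,
  parameters.\<close>

lemma recursive_rec_nat:
  assumes F: "recursive_in g k F"
    and G: "recursive_in g (Suc (Suc k)) (\<lambda>xs. G (hd xs) (hd (tl xs)) (tl (tl xs)))"
    and N: "recursive_in g k N"
  shows "recursive_in g k (\<lambda>xs. rec_nat (F xs) (\<lambda>n y. G n y xs) (N xs))"
proof -
  obtain p where p: "\<And>xs. length xs = k \<Longrightarrow> ev g p xs (F xs)"
    by (rule recursive_inE[OF F]) blast
  obtain q where q: "\<And>xs. length xs = Suc (Suc k) \<Longrightarrow>
      ev g q xs (G (hd xs) (hd (tl xs)) (tl (tl xs)))"
    by (rule recursive_inE[OF G]) blast
  obtain r where r: "\<And>xs. length xs = k \<Longrightarrow> ev g r xs (N xs)"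
    by (rule recursive_inE[OF N]) blast
  have Prec: "ev g (Prec p q) (n # xs) (rec_nat (F xs) (\<lambda>n y. G n y xs) n)"
    if xs: "length xs = k" for n xs
  proof (induction n)
    case 0
    show ?case using p[OF xs] by (auto intro: ev.Prec_0)
  next
    case (Suc n)
    then show ?case
      using q[of "n # rec_nat (F xs) (\<lambda>n y. G n y xs) n # xs"] xs by (auto intro: ev.Prec_Suc)
  qed
  show ?thesis
  proof (rule recursive_inI)
    fix xs :: "nat list" assume xs: "length xs = k"
    have "list_all2 (\<lambda>q y. ev g q xs y) (map Proj [0..<length xs]) (drop 0 xs)"
      by (rule list_all2_ev_Proj)
    then have "list_all2 (\<lambda>q y. ev g q xs y) (r # map Proj [0..<k]) (N xs # xs)"
      using r[OF xs] xs by simp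
    then show "ev g (Comp (Prec p q) (r # map Proj [0..<k])) xs
        (rec_nat (F xs) (\<lambda>n y. G n y xs) (N xs))"
      using Prec[OF xs] by (rule ev.Comp)
  qed
qed

section \<open>Arithmetic by primitive recursion\<close>

lemma recursive_add:
  assumes "recursive_in g k F" "recursive_in g k G"
  shows "recursive_in g k (\<lambda>xs. F xs + G xs)"
proof -
  have "rec_nat a (\<lambda>_ y. Suc y) b = a + b" for a b :: nat
    by (induction b) auto
  moreover have "recursive_in g k (\<lambda>xs. rec_nat (F xs) (\<lambda>n y. Suc y) (G xs))"
    by (intro recursive_rec_nat recursive_Suc recursive_hd_tl assms)
  ultimately show ?thesis by simp
qed

lemma recursive_mult:
  assumes "recursive_in g k F" "recursive_in g k G"
  shows "recursive_in g k (\<lambda>xs. F xs * G xs)"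
proof -
  have "rec_nat 0 (\<lambda>_ y. y + a) b = a * b" for a b :: nat
    by (induction b) auto
  moreover have "recursive_in g k (\<lambda>xs. rec_nat 0 (\<lambda>n y. y + F xs) (G xs))"
    by (intro recursive_rec_nat recursive_add recursive_hd_tl recursive_const assms
        assms(1)[THEN recursive_weaken, THEN recursive_weaken])
  ultimately show ?thesis by simp
qed

lemma recursive_power2:
  assumes "recursive_in g k F"
  shows "recursive_in g k (\<lambda>xs. 2 ^ F xs)"
proof -
  have "rec_nat 1 (\<lambda>_ y. y * 2) b = (2 :: nat) ^ b" for b :: nat
    by (induction b) auto
  moreover have "recursive_in g k (\<lambda>xs. rec_nat 1 (\<lambda>n y. y * 2) (F xs))"
    by (intro recursive_rec_nat recursive_mult recursive_hd_tl recursive_const assms)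
  ultimately show ?thesis by simp
qed

lemma recursive_triangle:
  assumes "recursive_in g k F"
  shows "recursive_in g k (\<lambda>xs. triangle (F xs))"
proof -
  have "rec_nat 0 (\<lambda>n y. y + Suc n) b = triangle b" for b :: nat
    by (induction b) auto
  moreover have "recursive_in g k (\<lambda>xs. rec_nat 0 (\<lambda>n y. y + Suc n) (F xs))"
    by (intro recursive_rec_nat recursive_add recursive_Suc recursive_hd recursive_hd_tl
        recursive_const assms)
  ultimately show ?thesis by simp
qed

lemma recursive_prod_encode:
  assumes "recursive_in g k F" "recursive_in g k G"
  shows "recursive_in g k (\<lambda>xs. prod_encode (F xs, G xs))"
  unfolding prod_encode_def prod.case by (intro recursive_add recursive_triangle assms)

lemma recursive_diff:
  assumes "recursive_in g k F" "recursive_in g k G"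
  shows "recursive_in g k (\<lambda>xs. F xs - G xs)"
proof -
  \<comment> \<open>The predecessor is a recursion that returns its counter; iterating it gives
    truncated subtraction.\<close>
  have pred: "rec_nat 0 (\<lambda>n _. n) b = b - 1" for b :: nat
    by (cases b) auto
  have "rec_nat a (\<lambda>_ y. y - 1) b = a - b" for a b :: nat
    by (induction b) auto
  moreover have "recursive_in g k (\<lambda>xs. rec_nat (F xs) (\<lambda>n y. y - 1) (G xs))"
    unfolding pred[symmetric]
    by (intro recursive_rec_nat recursive_hd recursive_hd_tl recursive_const assms)
  ultimately show ?thesis by simp
qed

section \<open>Decidable predicates and unbounded search\<close>

definition decidable_in :: "(nat \<Rightarrow> nat) \<Rightarrow> nat \<Rightarrow> (nat list \<Rightarrow> bool) \<Rightarrow> bool"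
  where "decidable_in g k P \<longleftrightarrow> recursive_in g k (\<lambda>xs. of_bool (P xs))"

lemma recursive_of_bool: "decidable_in g k P \<Longrightarrow> recursive_in g k (\<lambda>xs. of_bool (P xs))"
  unfolding decidable_in_def .

lemma decidable_not:
  assumes "decidable_in g k P"
  shows "decidable_in g k (\<lambda>xs. \<not> P xs)"
proof -
  have "recursive_in g k (\<lambda>xs. 1 - of_bool (P xs))"
    by (intro recursive_diff recursive_const recursive_of_bool assms)
  moreover have "1 - of_bool p = (of_bool (\<not> p) :: nat)" for p
    by simp
  ultimately show ?thesis by (simp only: decidable_in_def)
qed

lemma decidable_conj:
  assumes "decidable_in g k P" "decidable_in g k Q"
  shows "decidable_in g k (\<lambda>xs. P xs \<and> Q xs)"
  unfolding decidable_in_def of_bool_conj by (intro recursive_mult recursive_of_bool assms)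

lemma decidable_disj:
  assumes "decidable_in g k P" "decidable_in g k Q"
  shows "decidable_in g k (\<lambda>xs. P xs \<or> Q xs)"
proof -
  have "decidable_in g k (\<lambda>xs. \<not> (\<not> P xs \<and> \<not> Q xs))"
    by (intro decidable_not decidable_conj assms)
  then show ?thesis by simp
qed

lemma decidable_less:
  assumes "recursive_in g k F" "recursive_in g k G"
  shows "decidable_in g k (\<lambda>xs. F xs < G xs)"
proof -
  \<comment> \<open>With truncated subtraction, \<open>1 - (1 - n)\<close> is 0 at
    \<open>n = 0\<close> and 1 otherwise.\<close>
  have "of_bool (a < b) = 1 - (1 - (b - a))" for a b :: nat
    by auto
  then show ?thesis
    unfolding decidable_in_def
    by (simp only:) (intro recursive_diff recursive_const assms)
qed

lemma decidable_le:
  assumes "recursive_in g k F" "recursive_in g k G"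
  shows "decidable_in g k (\<lambda>xs. F xs \<le> G xs)"
  unfolding linorder_not_less[symmetric] by (intro decidable_not decidable_less assms)

lemma decidable_eq:
  assumes "recursive_in g k F" "recursive_in g k G"
  shows "decidable_in g k (\<lambda>xs. F xs = G xs)"
  unfolding order_eq_iff by (intro decidable_conj decidable_le assms)

lemma recursive_if:
  assumes "decidable_in g k P" "recursive_in g k F" "recursive_in g k G"
  shows "recursive_in g k (\<lambda>xs. if P xs then F xs else G xs)"
proof -
  have "recursive_in g k (\<lambda>xs. of_bool (P xs) * F xs + of_bool (\<not> P xs) * G xs)"
    by (intro recursive_add recursive_mult recursive_of_bool decidable_not assms)
  moreover have "of_bool p * a + of_bool (\<not> p) * b = (if p then a else b)" for p and a b :: nat
    by simp
  ultimately show ?thesis by simp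
qed

text \<open>\<open>Mu\<close> looks for a zero, hence it is run on the characteristic function of
  the negation. The assumption \<open>ex\<close> makes the search halt; it ranges over lists of
  every length.\<close>

lemma recursive_Least:
  assumes P: "decidable_in g (Suc k) (\<lambda>xs. P (hd xs) (tl xs))" and ex: "\<And>xs. \<exists>n. P n xs"
  shows "recursive_in g k (\<lambda>xs. LEAST n. P n xs)"
proof -
  obtain p where p: "\<And>xs. length xs = Suc k \<Longrightarrow> ev g p xs (of_bool (\<not> P (hd xs) (tl xs)))"
    by (rule recursive_inE[OF recursive_of_bool[OF decidable_not[OF P]]]) blast
  show ?thesis
  proof (intro recursive_inI[where p = "Mu p"] ev.Mu)
    fix xs :: "nat list" assume xs: "length xs = k"
    show "ev g p ((LEAST n. P n xs) # xs) 0"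
      using p[of "(LEAST n. P n xs) # xs"] LeastI_ex[OF ex[of xs]] xs by simp
    fix m assume "m < (LEAST n. P n xs)"
    then show "\<exists>y>0. ev g p (m # xs) y"
      using p[of "m # xs"] not_less_Least[of m "\<lambda>n. P n xs"] xs by auto
  qed
qed

lemma recursive_div_power2:
  assumes "recursive_in g k F" "recursive_in g k G"
  shows "recursive_in g k (\<lambda>xs. F xs div 2 ^ G xs)"
proof -
  \<comment> \<open>The quotient is the least \<open>q\<close> with
    \<open>a < Suc q * 2 ^ b\<close>, so division becomes a search.\<close>
  have less: "a < Suc q * 2 ^ b \<longleftrightarrow> a div 2 ^ b \<le> q" for a b q :: nat
    by (subst less_Suc_eq_le[symmetric], subst div_less_iff_less_mult) auto
  then have "(LEAST q. a < Suc q * 2 ^ b) = a div 2 ^ b" for a b :: nat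
    by (auto intro: Least_equality)
  moreover have "recursive_in g k (\<lambda>xs. LEAST q. F xs < Suc q * 2 ^ G xs)"
  proof (rule recursive_Least)
    show "decidable_in g (Suc k) (\<lambda>xs. F (tl xs) < Suc (hd xs) * 2 ^ G (tl xs))"
      by (intro decidable_less recursive_mult recursive_power2 recursive_Suc recursive_hd
          assms[THEN recursive_weaken])
    show "\<exists>q. F xs < Suc q * 2 ^ G xs" for xs
      using less by blast
  qed
  ultimately show ?thesis by simp
qed

lemma decidable_even:
  assumes "recursive_in g k F"
  shows "decidable_in g k (\<lambda>xs. even (F xs))"
proof -
  \<comment> \<open>Halving is written as division by \<open>2 ^ 1\<close>, the form covered by
    \<open>recursive_div_power2\<close>.\<close>
  have "even a \<longleftrightarrow> a = 2 * (a div 2 ^ 1)" for a :: nat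
    by (metis dvd_mult_div_cancel dvd_triv_left power_one_right)
  then show ?thesis
    by (simp only:) (intro decidable_eq recursive_mult recursive_const recursive_div_power2 assms)
qed

lemma decidable_bit:
  assumes "recursive_in g k F" "recursive_in g k G"
  shows "decidable_in g k (\<lambda>xs. bit (F xs) (G xs))"
  unfolding bit_iff_odd by (intro decidable_not decidable_even recursive_div_power2 assms)

section \<open>Least and greatest exponents\<close>

lemma bit_imp_power2_le: "bit n i \<Longrightarrow> 2 ^ i \<le> n" for n :: nat
  by (metis bit_iff_odd div_less even_zero linorder_not_less)

lemma finite_bits: "finite {i. bit n i}" for n :: nat
proof (rule finite_subset)
  show "{i. bit n i} \<subseteq> {..<n}"
    by (auto dest!: bit_imp_power2_le intro: less_le_trans[OF less_exp])
qed simp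

lemma bits_nonempty: "n > 0 \<Longrightarrow> {i. bit n i} \<noteq> {}" for n :: nat
proof
  assume "n > 0" "{i. bit n i} = {}"
  from this(2) have "n = 0" by (intro bit_eqI) auto
  with \<open>n > 0\<close> show False by simp
qed

lemma least_exponent_eq_Least: "n > 0 \<Longrightarrow> least_exponent n = (LEAST i. bit n i)"
  unfolding least_exponent_def using finite_bits bits_nonempty[of n] by (subst Least_Min) auto

lemma bit_least_exponent: "n > 0 \<Longrightarrow> bit n (least_exponent n)"
  using Min_in[OF finite_bits bits_nonempty] by (simp add: least_exponent_def)

lemma bit_greatest_exponent: "n > 0 \<Longrightarrow> bit n (greatest_exponent n)"
  using Max_in[OF finite_bits bits_nonempty] by (simp add: greatest_exponent_def)

lemma least_exponent_le: "bit n i \<Longrightarrow> least_exponent n \<le> i"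
  unfolding least_exponent_def using finite_bits by (intro Min_le) auto

lemma greatest_exponent_ge: "bit n i \<Longrightarrow> i \<le> greatest_exponent n"
  unfolding greatest_exponent_def using finite_bits by (intro Max_ge) auto

lemma least_exponent_le_greatest_exponent: "n > 0 \<Longrightarrow> least_exponent n \<le> greatest_exponent n"
  by (intro least_exponent_le bit_greatest_exponent)

lemma power2_greatest_exponent_le: "n > 0 \<Longrightarrow> 2 ^ greatest_exponent n \<le> n"
  by (intro bit_imp_power2_le bit_greatest_exponent)

lemma power2_least_exponent_le: "n > 0 \<Longrightarrow> 2 ^ least_exponent n \<le> n"
  by (intro bit_imp_power2_le bit_least_exponent)

text \<open>Truncation to the lowest \<open>Suc (greatest_exponent n)\<close> bits loses nothing,
  since no bit lies higher.\<close>

lemma less_power2_Suc_greatest_exponent: "n < 2 ^ Suc (greatest_exponent n)"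
proof -
  have "take_bit (Suc (greatest_exponent n)) n = n"
    by (rule bit_eqI) (auto simp: bit_take_bit_iff less_Suc_eq_le dest: greatest_exponent_ge)
  then show ?thesis by (simp only: take_bit_nat_eq_self_iff)
qed

lemma greatest_exponent_eq_Least:
  assumes "n > 0"
  shows "greatest_exponent n = (LEAST i. n < 2 ^ Suc i)"
proof (rule Least_equality[symmetric])
  fix i assume "n < 2 ^ Suc i"
  with power2_greatest_exponent_le[OF assms]
  have "(2 :: nat) ^ greatest_exponent n < 2 ^ Suc i" by (rule le_less_trans)
  then show "greatest_exponent n \<le> i"
    by (simp add: less_Suc_eq_le del: power_Suc)
qed (rule less_power2_Suc_greatest_exponent)

text \<open>No bit is shared, so there are no carries: the sum is the bitwise or, and its exponents
  are the union of those of \<open>x\<close> and \<open>y\<close>.\<close>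

lemma exponents_add:
  assumes "x > 0" "y > 0" and less: "greatest_exponent x < least_exponent y"
  shows "least_exponent (x + y) = least_exponent x"
    and "greatest_exponent (x + y) = greatest_exponent y"
proof -
  have "and x y = 0"
    using less
    by (intro bit_eqI) (force simp: bit_and_iff dest: least_exponent_le greatest_exponent_ge)
  then have "x + y = or x y" by (rule disjunctive_add_eq_or)
  then have bits: "{i. bit (x + y) i} = {i. bit x i} \<union> {i. bit y i}"
    by (auto simp: bit_or_iff)
  have "least_exponent (x + y) = min (least_exponent x) (least_exponent y)"
    unfolding least_exponent_def bits by (intro Min_Un finite_bits bits_nonempty assms)
  moreover have "greatest_exponent (x + y) = max (greatest_exponent x) (greatest_exponent y)"
    unfolding greatest_exponent_def bits by (intro Max_Un finite_bits bits_nonempty assms)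
  moreover note less least_exponent_le_greatest_exponent[OF assms(1)]
    least_exponent_le_greatest_exponent[OF assms(2)]
  ultimately show "least_exponent (x + y) = least_exponent x"
    "greatest_exponent (x + y) = greatest_exponent y" by simp_all
qed

text \<open>At 0 the least exponent is the unspecified \<open>Min {}\<close>, so the function shown
  recursive is given the value 0 there.\<close>

lemma recursive_least_exponent:
  assumes "recursive_in g k F"
  shows "recursive_in g k (\<lambda>xs. if F xs = 0 then 0 else least_exponent (F xs))"
proof -
  \<comment> \<open>The disjunct \<open>F xs = 0\<close> makes the search succeed on every list and
    yields the default 0.\<close>
  have "recursive_in g k (\<lambda>xs. LEAST i. F xs = 0 \<or> bit (F xs) i)"
  proof (rule recursive_Least)
    show "decidable_in g (Suc k) (\<lambda>xs. F (tl xs) = 0 \<or> bit (F (tl xs)) (hd xs))"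
      by (intro decidable_disj decidable_eq decidable_bit recursive_const recursive_hd
          assms[THEN recursive_weaken])
    show "\<exists>i. F xs = 0 \<or> bit (F xs) i" for xs
      using bit_least_exponent by blast
  qed
  moreover have "(LEAST i. n = 0 \<or> bit n i) = (if n = 0 then 0 else least_exponent n)"
    for n :: nat
    using least_exponent_eq_Least by auto
  ultimately show ?thesis by simp
qed

lemma recursive_greatest_exponent:
  assumes "recursive_in g k F"
  shows "recursive_in g k (\<lambda>xs. if F xs = 0 then 0 else greatest_exponent (F xs))"
proof -
  \<comment> \<open>When \<open>F xs = 0\<close> the search stops at \<open>i = 0\<close>, which is
    the default value.\<close>
  have "recursive_in g k (\<lambda>xs. LEAST i. F xs < 2 ^ Suc i)"
  proof (rule recursive_Least)
    show "decidable_in g (Suc k) (\<lambda>xs. F (tl xs) < 2 ^ Suc (hd xs))"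
      by (intro decidable_less recursive_power2 recursive_Suc recursive_hd
          assms[THEN recursive_weaken])
    show "\<exists>i. F xs < 2 ^ Suc i" for xs
      using less_power2_Suc_greatest_exponent by blast
  qed
  moreover have "(LEAST i. n < 2 ^ Suc i) = (if n = 0 then 0 else greatest_exponent n)"
    for n :: nat
    using greatest_exponent_eq_Least[of n] by (auto intro: Least_equality)
  ultimately show ?thesis by simp
qed

section \<open>Infinite apart sets\<close>

text \<open>For \<open>h \<in> H\<close> this is the position of \<open>h\<close> in the increasing
  enumeration of \<open>H\<close>, counted from 0.\<close>

definition index_in :: "nat set \<Rightarrow> nat \<Rightarrow> nat"
  where "index_in H h = card (H \<inter> {..<h})"

definition next_in :: "nat set \<Rightarrow> nat \<Rightarrow> nat"
  where "next_in H n = (LEAST h. h \<in> H \<and> n \<le> h)"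

lemma index_in_Suc: "index_in H (Suc n) = index_in H n + of_bool (n \<in> H)"
proof -
  have "H \<inter> {..<Suc n} = (if n \<in> H then insert n (H \<inter> {..<n}) else H \<inter> {..<n})"
    by (auto simp: less_Suc_eq)
  then show ?thesis by (simp add: index_in_def)
qed

lemma next_in:
  assumes "infinite H"
  shows "next_in H n \<in> H" "n \<le> next_in H n"
proof -
  have "\<exists>h. h \<in> H \<and> n \<le> h"
    using assms by (meson infinite_nat_iff_unbounded_le)
  then have "next_in H n \<in> H \<and> n \<le> next_in H n"
    unfolding next_in_def by (rule LeastI_ex)
  then show "next_in H n \<in> H" "n \<le> next_in H n" by auto
qed

lemma next_in_eqI: "h \<in> H \<Longrightarrow> n \<le> h \<Longrightarrow> (\<And>h'. h' \<in> H \<Longrightarrow> h' < h \<Longrightarrow> h' < n) \<Longrightarrow> next_in H n = h"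
  unfolding next_in_def by (rule Least_equality) (meson linorder_not_less)+

text \<open>No element of \<open>H\<close> lies in the interval from \<open>n\<close> up to, but
  excluding, \<open>next_in H n\<close>.\<close>

lemma index_in_next_in: "index_in H (next_in H n) = index_in H n" if "infinite H"
proof -
  have "h < n" if "h \<in> H" "h < next_in H n" for h
    using that not_less_Least[of h "\<lambda>h. h \<in> H \<and> n \<le> h"] by (auto simp: next_in_def)
  then have "H \<inter> {..<next_in H n} = H \<inter> {..<n}"
    using next_in(2)[OF that, of n] by auto
  then show ?thesis by (simp add: index_in_def)
qed

text \<open>Indices of consecutive elements differ by one, so one of the first two elements of
  \<open>H\<close> from \<open>m\<close> on has the wanted parity.\<close>

lemma infinite_index_parity:
  assumes "infinite H"
  shows "infinite {h \<in> H. even (index_in H h) = b}"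
  unfolding infinite_nat_iff_unbounded_le
proof
  fix m
  define h where "h = next_in H m"
  have h: "h \<in> H" "m \<le> h" using next_in[OF assms] by (simp_all add: h_def)
  show "\<exists>n\<ge>m. n \<in> {h \<in> H. even (index_in H h) = b}"
  proof (cases "even (index_in H h) = b")
    case True
    with h show ?thesis by blast
  next
    case False
    have "index_in H (next_in H (Suc h)) = Suc (index_in H h)"
      using h by (simp add: index_in_next_in[OF assms] index_in_Suc)
    with False have "even (index_in H (next_in H (Suc h))) = b" by auto
    moreover have "m \<le> next_in H (Suc h)"
      using h next_in(2)[OF assms, of "Suc h"] by simp
    ultimately show ?thesis using next_in(1)[OF assms] by blast
  qed
qed

lemma recursive_index_in:
  assumes "recursive_in (set_code H) k F"
  shows "recursive_in (set_code H) k (\<lambda>xs. index_in H (F xs))"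
proof -
  \<comment> \<open>Summing the answers of the oracle below \<open>b\<close> counts the elements of
    \<open>H\<close> there.\<close>
  have "rec_nat 0 (\<lambda>n y. y + set_code H n) b = index_in H b" for b
    by (induction b) (simp_all add: index_in_Suc set_code_def, simp add: index_in_def)
  moreover have "recursive_in (set_code H) k (\<lambda>xs. rec_nat 0 (\<lambda>n y. y + set_code H n) (F xs))"
    by (intro recursive_rec_nat recursive_add recursive_oracle recursive_hd recursive_hd_tl
        recursive_const assms)
  ultimately show ?thesis by simp
qed

lemma recursive_next_in:
  assumes "infinite H" "recursive_in (set_code H) k F"
  shows "recursive_in (set_code H) k (\<lambda>xs. next_in H (F xs))"
proof -
  have mem: "h \<in> H \<longleftrightarrow> set_code H h = 1" for h
    by (simp add: set_code_def)
  have "recursive_in (set_code H) k (\<lambda>xs. LEAST h. set_code H h = 1 \<and> F xs \<le> h)"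
  proof (rule recursive_Least)
    show "decidable_in (set_code H) (Suc k) (\<lambda>xs. set_code H (hd xs) = 1 \<and> F (tl xs) \<le> hd xs)"
      by (intro decidable_conj decidable_eq decidable_le recursive_oracle recursive_hd
          recursive_const assms(2)[THEN recursive_weaken])
    show "\<exists>h. set_code H h = 1 \<and> F xs \<le> h" for xs
      using next_in[OF assms(1)] mem by blast
  qed
  then show ?thesis by (simp add: next_in_def mem)
qed

section \<open>Recovering an element of an apart set from its exponents\<close>

lemma apart_less_power2:
  assumes "apart H" "0 \<notin> H" "h \<in> H" "h' \<in> H" "h' < h" "least_exponent h \<le> m"
  shows "h' < 2 ^ m"
proof -
  have "greatest_exponent h' < least_exponent h"
    using assms by (simp add: apart_def)
  then have "(2 :: nat) ^ Suc (greatest_exponent h') \<le> 2 ^ m"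
    using assms(6) by (intro power_increasing) auto
  then show ?thesis
    using less_power2_Suc_greatest_exponent[of h'] by linarith
qed

text \<open>For either exponent \<open>m\<close> of \<open>h\<close>, \<open>2 ^ m \<le> h\<close>,
  while apartness puts all bits of a smaller element of \<open>H\<close> below \<open>m\<close>.
  This yields both the injectivity of the exponents on \<open>H\<close> and the decision procedure
  for their images.\<close>

lemma apart_next_in_power2:
  assumes "apart H" "0 \<notin> H" "h \<in> H"
  shows "next_in H (2 ^ least_exponent h) = h" "next_in H (2 ^ greatest_exponent h) = h"
proof -
  have h: "h > 0" using assms by (cases h) auto
  show "next_in H (2 ^ least_exponent h) = h"
    using assms power2_least_exponent_le[OF h] by (intro next_in_eqI apart_less_power2) auto
  show "next_in H (2 ^ greatest_exponent h) = h"
    using assms power2_greatest_exponent_le[OF h] least_exponent_le_greatest_exponent[OF h]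
    by (intro next_in_eqI apart_less_power2) auto
qed

text \<open>An exponent may be 0, whereas solutions of \<open>IPT_2_2\<close> consist of positive
  integers; hence the removal of 0, here and in \<open>odd_greatest_exponents\<close>.\<close>

definition even_least_exponents :: "nat set \<Rightarrow> nat set"
  where "even_least_exponents H = least_exponent ` {h \<in> H. even (index_in H h)} - {0}"

definition odd_greatest_exponents :: "nat set \<Rightarrow> nat set"
  where "odd_greatest_exponents H = greatest_exponent ` {h \<in> H. odd (index_in H h)} - {0}"

text \<open>Both exponent functions have the left inverse
  \<open>\<lambda>m. next_in H (2 ^ m)\<close> on \<open>H\<close>, so they are injective on the two
  infinite halves of \<open>H\<close>.\<close>

lemma infinite_exponents:
  assumes "apart H" "0 \<notin> H" "infinite H"
  shows "infinite (even_least_exponents H)" "infinite (odd_greatest_exponents H)"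
proof -
  have "inj_on least_exponent H" "inj_on greatest_exponent H"
    using apart_next_in_power2[OF assms(1,2)] by (metis inj_onI)+
  then have "inj_on least_exponent {h \<in> H. even (index_in H h)}"
    "inj_on greatest_exponent {h \<in> H. odd (index_in H h)}"
    by (auto elim: inj_on_subset)
  then show "infinite (even_least_exponents H)" "infinite (odd_greatest_exponents H)"
    using infinite_index_parity[OF assms(3), of True] infinite_index_parity[OF assms(3), of False]
    by (simp_all add: even_least_exponents_def odd_greatest_exponents_def finite_image_iff)
qed

lemma exponents_computable:
  assumes "apart H" "0 \<notin> H" "infinite H"
  shows "set_pair_code (even_least_exponents H, odd_greatest_exponents H) \<le>\<^sub>T set_code H"
proof -
  define N where "N m = next_in H (2 ^ m)" for m
  have N: "N m \<in> H" "N m > 0" for m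
    using next_in[OF assms(3), of "2 ^ m"] assms(2) by (auto simp: N_def intro: gr0I)
  \<comment> \<open>Any \<open>h \<in> H\<close> with \<open>e h = m\<close> equals
    \<open>N m\<close>, so membership in the image is a check at one computable point instead of a
    search through \<open>H\<close>.\<close>
  have image: "m \<in> e ` {h \<in> H. P h} \<longleftrightarrow> e (N m) = m \<and> P (N m)"
    if "\<And>h. h \<in> H \<Longrightarrow> N (e h) = h" for e m P
    by (auto simp: that intro!: image_eqI[of m e "N m"] N(1))
  \<comment> \<open>The guard matches the form of \<open>recursive_least_exponent\<close>; as
    \<open>N m > 0\<close>, the value is the least exponent of \<open>N m\<close>.\<close>
  have even: "m \<in> even_least_exponents H \<longleftrightarrow>
      0 < m \<and> (if N m = 0 then 0 else least_exponent (N m)) = m \<and> even (index_in H (N m))" for m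
    using N(2)[of m] image[of least_exponent m "\<lambda>h. even (index_in H h)"]
      apart_next_in_power2(1)[OF assms(1,2)]
    by (auto simp: even_least_exponents_def N_def)
  have odd: "m \<in> odd_greatest_exponents H \<longleftrightarrow>
      0 < m \<and> (if N m = 0 then 0 else greatest_exponent (N m)) = m \<and> \<not> even (index_in H (N m))" for m
    using N(2)[of m] image[of greatest_exponent m "\<lambda>h. odd (index_in H h)"]
      apart_next_in_power2(2)[OF assms(1,2)]
    by (auto simp: odd_greatest_exponents_def N_def)
  have code: "set_pair_code (even_least_exponents H, odd_greatest_exponents H) =
      (\<lambda>n. if even n then of_bool (n div 2 ^ 1 \<in> even_least_exponents H)
        else of_bool (n div 2 ^ 1 \<in> odd_greatest_exponents H))"
    by (auto simp: set_pair_code_def set_code_def)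
  have half: "recursive_in (set_code H) 1 (\<lambda>xs. hd xs div 2 ^ 1)"
    unfolding One_nat_def by (intro recursive_div_power2 recursive_hd recursive_const)
  have rec_N: "recursive_in (set_code H) 1 (\<lambda>xs. N (hd xs div 2 ^ 1))"
    unfolding N_def by (intro recursive_next_in recursive_power2 half assms(3))
  show ?thesis
    unfolding computable_from_iff_recursive_in code even odd
    by (intro recursive_if recursive_of_bool decidable_even decidable_conj decidable_not
        decidable_less decidable_eq recursive_least_exponent recursive_greatest_exponent
        recursive_index_in recursive_const half rec_N recursive_hd[of _ 0, folded One_nat_def])
qed

section \<open>The reduction\<close>

text \<open>Going through the code makes each value a single oracle query. It also gives 0 when the
  two exponents coincide, where \<open>c\<close> would be applied to a singleton and be
  arbitrary.\<close>

definition exponent_colouring :: "(nat set \<Rightarrow> nat) \<Rightarrow> nat \<Rightarrow> nat"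
  where "exponent_colouring c n =
    pair_colouring_code c (prod_encode (least_exponent n, greatest_exponent n))"

lemma exponent_colouring_eq:
  "exponent_colouring c n = (if least_exponent n \<noteq> greatest_exponent n
    then c {least_exponent n, greatest_exponent n} else 0)"
  by (simp add: exponent_colouring_def pair_colouring_code_def)

lemma exponent_colouring_computable:
  "colouring_code (exponent_colouring c) \<le>\<^sub>T pair_colouring_code c"
proof -
  \<comment> \<open>\<open>colouring_code\<close> is 0 at 0, so the exponents can be replaced by
    their versions with default 0.\<close>
  have code: "colouring_code (exponent_colouring c) = (\<lambda>n. if 1 \<le> n
      then pair_colouring_code c (prod_encode (if n = 0 then 0 else least_exponent n,
        if n = 0 then 0 else greatest_exponent n)) else 0)"
    by (auto simp: colouring_code_def exponent_colouring_def)
  show ?thesis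
    unfolding computable_from_iff_recursive_in code
    by (intro recursive_if recursive_oracle recursive_prod_encode decidable_le recursive_const
        recursive_least_exponent recursive_greatest_exponent
        recursive_hd[of _ 0, folded One_nat_def])
qed

text \<open>Opposite index parities force \<open>x \<noteq> y\<close>, and \<open>y < x\<close>
  would give \<open>x2 < x1\<close> by apartness. Hence \<open>x < y\<close>, and
  \<open>c {x1, x2}\<close> is the colour of \<open>x + y\<close>.\<close>

lemma exponents_monochromatic:
  assumes "apart H" "0 \<notin> H"
    and mono: "\<And>x y. x \<in> H \<Longrightarrow> y \<in> H \<Longrightarrow> x \<noteq> y \<Longrightarrow> exponent_colouring c (x + y) = i"
    and "x1 \<in> even_least_exponents H" "x2 \<in> odd_greatest_exponents H" "x1 < x2"
  shows "c {x1, x2} = i"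
proof -
  obtain x y where x: "x \<in> H" "even (index_in H x)" "x1 = least_exponent x"
    and y: "y \<in> H" "odd (index_in H y)" "x2 = greatest_exponent y"
    using assms(4,5) by (auto simp: even_least_exponents_def odd_greatest_exponents_def)
  have "x \<noteq> y" using x y by auto
  moreover have "\<not> y < x" using assms(1,6) x y by (fastforce simp: apart_def)
  ultimately have less: "greatest_exponent x < least_exponent y"
    using assms(1) x y by (auto simp: apart_def)
  have "x > 0" "y > 0" using assms(2) x(1) y(1) by (auto intro: gr0I)
  \<comment> \<open>By \<open>x1 < x2\<close> the exponents of \<open>x + y\<close> are distinct, so
    the default colour does not arise.\<close>
  then have "exponent_colouring c (x + y) = c {x1, x2}"
    using assms(6) x y by (simp add: exponent_colouring_eq exponents_add less)
  then show ?thesis using mono[OF x(1) y(1) \<open>x \<noteq> y\<close>] by simp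
qed

theorem theorem3:
  shows "IPT_2_2 \<le>\<^sub>s\<^sub>c HT_exactly_2_2_apart"
  unfolding strongly_computably_reducible_def
proof
  fix c assume "c \<in> instances IPT_2_2"
  then have "c {x, y} < 2" if "x \<noteq> y" for x y
    using that by (auto simp: IPT_2_2_def nsets_def Pi_iff)
  \<comment> \<open>The bound on \<open>c\<close> covers distinct exponents, and the default colour
    0 covers equal ones.\<close>
  then have inst: "exponent_colouring c \<in> instances HT_exactly_2_2_apart"
    by (simp add: HT_exactly_2_2_apart_def exponent_colouring_eq)
  have "\<exists>T\<in>solutions IPT_2_2 c. scode IPT_2_2 T \<le>\<^sub>T scode HT_exactly_2_2_apart H"
    if "H \<in> solutions HT_exactly_2_2_apart (exponent_colouring c)" for H
  proof -
    from that have H: "apart H" "0 \<notin> H" "infinite H"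
      by (auto simp: HT_exactly_2_2_apart_def)
    from that obtain i
      where i: "\<forall>z \<in> {x + y | x y. x \<in> H \<and> y \<in> H \<and> x \<noteq> y}. exponent_colouring c z = i"
      unfolding HT_exactly_2_2_apart_def problem.simps by blast
    have mono: "exponent_colouring c (x + y) = i" if "x \<in> H" "y \<in> H" "x \<noteq> y" for x y
      using i that by blast
    show ?thesis
    proof
      show "(even_least_exponents H, odd_greatest_exponents H) \<in> solutions IPT_2_2 c"
        using infinite_exponents[OF H] exponents_monochromatic[OF H(1,2) mono]
        by (auto simp: IPT_2_2_def even_least_exponents_def odd_greatest_exponents_def)
      show "scode IPT_2_2 (even_least_exponents H, odd_greatest_exponents H) \<le>\<^sub>T
          scode HT_exactly_2_2_apart H"
        using exponents_computable[OF H] by (simp add: IPT_2_2_def HT_exactly_2_2_apart_def)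
    qed
  qed
  then show "\<exists>J\<in>instances HT_exactly_2_2_apart.
      icode HT_exactly_2_2_apart J \<le>\<^sub>T icode IPT_2_2 c \<and>
      (\<forall>S\<in>solutions HT_exactly_2_2_apart J. \<exists>T\<in>solutions IPT_2_2 c.
        scode IPT_2_2 T \<le>\<^sub>T scode HT_exactly_2_2_apart S)"
    using inst exponent_colouring_computable[of c]
    by (intro bexI[of _ "exponent_colouring c"]) (auto simp: IPT_2_2_def HT_exactly_2_2_apart_def)
qed

end
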